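(* Suppose the collective choice problem $\mathcal C$ satisfies Thin Individual Indifference. The following holds if and only if $\mathcal C$ is Manipulable: for every $\delta>0$ there exist $\epsilon_\delta>0$ and $T_\delta\in\mathbb N$ such that, whenever the policy space is restricted to any generic $\epsilon$-grid $X_\epsilon$ with $\epsilon<\epsilon_\delta$ and the amendment procedure has at least $T_\delta$ rounds, then for any initial default in $X_\epsilon$ the agenda setter's payoff is at least $u_A^*-\delta$ in every equilibrium.
   Context: Collective choice problem $\mathcal C$: voters $N=\{1,\dots,n\}$ ($n$ odd) and a non-voting agenda setter $A$ choose from a compact metrizable policy space $X$ with metric $d$; each player $i\in N\cup\{A\}$ has a complete, transitive, continuous preference $\succsim_i$ with continuous utility $u_i$. $x\succ_M y$ means a strict majority of voters strictly prefer $x$ to $y$. $X_A^*=\arg\max_X u_A$, $u_A^*=\max_{x\in X}u_A(x)$. $x$ is Improvable if some $y$ has $y\succ_A x$ and $y\succ_M x$; $\mathcal C$ is Manipulable if every $x\notin X_A^*$ is Improvable. For $i$ and $x$, $I_i(x)=\{y\in X: y\sim_i x\}$; $\mathcal C$ satisfies Thin Individual Indifference if $I_i(x)\setminus\{x\}$ has empty interior for every player $i$ and $x\in X$. For $A\subseteq X$, $d(x,A)=\inf_{y\in A}d(x,y)$. A generic $\epsilon$-grid is a finite set $X_\epsilon\subseteq X$ with $\max_{x\in X}d(x,X_\epsilon)<\epsilon$ on which all players' preferences are antisymmetric. Restricting the policy space to $X_\epsilon$ means all proposals and defaults lie in $X_\epsilon$ and preferences are the restrictions. Amendment procedure with $T$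 rounds: initial default $x^0$; in each round the agenda setter proposes a policy voted against the current default by simple majority; if it passes it becomes the new default, otherwise the default is unchanged; the final default is implemented. Strategies may depend on full histories and may be mixed. Equilibrium: subgame perfect equilibrium with as-if-pivotal voting (at histories where passage leads to continuation outcome $x$ and rejection to $y$ regardless of the composition of the vote, any voter with a strict preference between $x$ and $y$ votes for the option leading to her preferred outcome). *)

theory Defs
  imports "HOL-Analysis.Analysis" "HOL-Probability.Product_PMF"
begin

text \<open>Voters are indexed by {..<n} (standing for N = {1,...,n}); voter i has utility u i,
  the agenda setter A has utility uA. The policy space is a set X in a metric space.\<close>

definition strict_maj :: "nat \<Rightarrow> (nat \<Rightarrow> 'x \<Rightarrow> real) \<Rightarrow> 'x \<Rightarrow> 'x \<Rightarrow> bool" where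
  "strict_maj n u x y \<longleftrightarrow> 2 * card {i \<in> {..<n}. u i x > u i y} > n"

definition setter_opt :: "'x set \<Rightarrow> ('x \<Rightarrow> real) \<Rightarrow> 'x set" where
  "setter_opt X uA = {x \<in> X. \<forall>y\<in>X. uA y \<le> uA x}"

definition setter_max :: "'x set \<Rightarrow> ('x \<Rightarrow> real) \<Rightarrow> real" where
  "setter_max X uA = Sup (uA ` X)"

definition improvable :: "'x set \<Rightarrow> nat \<Rightarrow> (nat \<Rightarrow> 'x \<Rightarrow> real) \<Rightarrow> ('x \<Rightarrow> real) \<Rightarrow> 'x \<Rightarrow> bool" where
  "improvable X n u uA x \<longleftrightarrow> (\<exists>y\<in>X. uA y > uA x \<and> strict_maj n u y x)"

definition manipulable :: "'x set \<Rightarrow> nat \<Rightarrow> (nat \<Rightarrow> 'x \<Rightarrow> real) \<Rightarrow> ('x \<Rightarrow> real) \<Rightarrow> bool" where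
  "manipulable X n u uA \<longleftrightarrow> (\<forall>x\<in>X. x \<notin> setter_opt X uA \<longrightarrow> improvable X n u uA x)"

definition indiff_set :: "'x set \<Rightarrow> ('x \<Rightarrow> real) \<Rightarrow> 'x \<Rightarrow> 'x set" where
  "indiff_set X v x = {y \<in> X. v y = v x}"

definition thin_indiff_player :: "'x::topological_space set \<Rightarrow> ('x \<Rightarrow> real) \<Rightarrow> bool" where
  "thin_indiff_player X v \<longleftrightarrow>
     (\<forall>x\<in>X. (top_of_set X) interior_of (indiff_set X v x - {x}) = {})"

definition thin_individual_indifference ::
  "'x::topological_space set \<Rightarrow> nat \<Rightarrow> (nat \<Rightarrow> 'x \<Rightarrow> real) \<Rightarrow> ('x \<Rightarrow> real) \<Rightarrow> bool" where
  "thin_individual_indifference X n u uA \<longleftrightarrow>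
     (\<forall>i<n. thin_indiff_player X (u i)) \<and> thin_indiff_player X uA"

text \<open>Generic epsilon-grid: a finite (nonempty, since d(x,{}) = +infinity) subset of X
  whose maximal distance to points of X is below eps, on which every player's preference
  is antisymmetric.\<close>
definition generic_grid ::
  "'x::metric_space set \<Rightarrow> nat \<Rightarrow> (nat \<Rightarrow> 'x \<Rightarrow> real) \<Rightarrow> ('x \<Rightarrow> real) \<Rightarrow> real \<Rightarrow> 'x set \<Rightarrow> bool" where
  "generic_grid X n u uA eps G \<longleftrightarrow>
     finite G \<and> G \<noteq> {} \<and> G \<subseteq> X \<and>
     (SUP x\<in>X. infdist x G) < eps \<and>
     (\<forall>i<n. \<forall>x\<in>G. \<forall>y\<in>G. u i x = u i y \<longrightarrow> x = y) \<and>
     (\<forall>x\<in>G. \<forall>y\<in>G. uA x = uA y \<longrightarrow> x = y)"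

text \<open>A history is the list of past rounds: the proposal and the set of voters who voted
  in favour. Behavioural (mixed) strategies depend on full histories.\<close>
type_synonym 'x hist = "('x \<times> nat set) list"
type_synonym 'x setter_strat = "'x hist \<Rightarrow> 'x pmf"
type_synonym 'x voter_strat = "'x hist \<Rightarrow> 'x \<Rightarrow> bool pmf"

definition passes :: "nat \<Rightarrow> nat set \<Rightarrow> bool" where
  "passes n S \<longleftrightarrow> 2 * card (S \<inter> {..<n}) > n"

definition cur_default :: "nat \<Rightarrow> 'x \<Rightarrow> 'x hist \<Rightarrow> 'x" where
  "cur_default n x0 h = foldl (\<lambda>d (y, S). if passes n S then y else d) x0 h"

definition votes :: "nat \<Rightarrow> (nat \<Rightarrow> 'x voter_strat) \<Rightarrow> 'x hist \<Rightarrow> 'x \<Rightarrow> nat set pmf" where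
  "votes n sV h y = map_pmf (\<lambda>f. {i. f i}) (Pi_pmf {..<n} False (\<lambda>i. sV i h y))"

primrec play :: "nat \<Rightarrow> 'x \<Rightarrow> 'x setter_strat \<Rightarrow> (nat \<Rightarrow> 'x voter_strat) \<Rightarrow> nat \<Rightarrow> 'x hist \<Rightarrow> 'x pmf" where
  "play n x0 sA sV 0 h = return_pmf (cur_default n x0 h)"
| "play n x0 sA sV (Suc k) h =
     bind_pmf (sA h) (\<lambda>y. bind_pmf (votes n sV h y) (\<lambda>S. play n x0 sA sV k (h @ [(y, S)])))"

definition playV :: "nat \<Rightarrow> 'x \<Rightarrow> 'x setter_strat \<Rightarrow> (nat \<Rightarrow> 'x voter_strat) \<Rightarrow> nat \<Rightarrow> 'x hist \<Rightarrow> 'x \<Rightarrow> 'x pmf" where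
  "playV n x0 sA sV k h y = bind_pmf (votes n sV h y) (\<lambda>S. play n x0 sA sV k (h @ [(y, S)]))"

definition EU :: "('x \<Rightarrow> real) \<Rightarrow> 'x pmf \<Rightarrow> real" where
  "EU v p = measure_pmf.expectation p v"

definition valid_setter :: "'x set \<Rightarrow> 'x setter_strat \<Rightarrow> bool" where
  "valid_setter G sA \<longleftrightarrow> (\<forall>h. set_pmf (sA h) \<subseteq> G)"

definition valid_hist :: "'x set \<Rightarrow> nat \<Rightarrow> nat \<Rightarrow> 'x hist \<Rightarrow> bool" where
  "valid_hist G n T h \<longleftrightarrow> length h < T \<and> (\<forall>(y, S)\<in>set h. y \<in> G \<and> S \<subseteq> {..<n})"

text \<open>Nash equilibrium in the subgame whose outcome is given by the function out
  (of the strategy profile): no player gains by deviating (to any strategy).\<close>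
definition nash_in :: "'x set \<Rightarrow> nat \<Rightarrow> (nat \<Rightarrow> 'x \<Rightarrow> real) \<Rightarrow> ('x \<Rightarrow> real)
   \<Rightarrow> ('x setter_strat \<Rightarrow> (nat \<Rightarrow> 'x voter_strat) \<Rightarrow> 'x pmf)
   \<Rightarrow> 'x setter_strat \<Rightarrow> (nat \<Rightarrow> 'x voter_strat) \<Rightarrow> bool" where
  "nash_in G n u uA out sA sV \<longleftrightarrow>
     (\<forall>sA'. valid_setter G sA' \<longrightarrow> EU uA (out sA' sV) \<le> EU uA (out sA sV)) \<and>
     (\<forall>i<n. \<forall>si'. EU (u i) (out sA (sV(i := si'))) \<le> EU (u i) (out sA sV))"

definition as_if_pivotal :: "nat \<Rightarrow> (nat \<Rightarrow> 'x \<Rightarrow> real) \<Rightarrow> 'x \<Rightarrow> nat \<Rightarrow>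
   'x setter_strat \<Rightarrow> (nat \<Rightarrow> 'x voter_strat) \<Rightarrow> 'x hist \<Rightarrow> 'x \<Rightarrow> bool" where
  "as_if_pivotal n u x0 k sA sV h y \<longleftrightarrow>
     (\<forall>x z. (\<forall>S\<subseteq>{..<n}. passes n S \<longrightarrow> play n x0 sA sV k (h @ [(y, S)]) = return_pmf x) \<and>
            (\<forall>S\<subseteq>{..<n}. \<not> passes n S \<longrightarrow> play n x0 sA sV k (h @ [(y, S)]) = return_pmf z) \<longrightarrow>
        (\<forall>i<n. (u i x > u i z \<longrightarrow> sV i h y = return_pmf True) \<and>
               (u i z > u i x \<longrightarrow> sV i h y = return_pmf False)))"

text \<open>Subgame perfect equilibrium with as-if-pivotal voting of the T-round amendment
  procedure on the grid G with initial default x0. Subgames start at every history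
  (before the setter's proposal) and at every voting node (after a proposal).\<close>
definition equilibrium :: "'x set \<Rightarrow> nat \<Rightarrow> (nat \<Rightarrow> 'x \<Rightarrow> real) \<Rightarrow> ('x \<Rightarrow> real) \<Rightarrow> nat \<Rightarrow> 'x
   \<Rightarrow> 'x setter_strat \<Rightarrow> (nat \<Rightarrow> 'x voter_strat) \<Rightarrow> bool" where
  "equilibrium G n u uA T x0 sA sV \<longleftrightarrow>
     valid_setter G sA \<and>
     (\<forall>h. valid_hist G n T h \<longrightarrow>
        nash_in G n u uA (\<lambda>a v. play n x0 a v (T - length h) h) sA sV \<and>
        (\<forall>y\<in>G. nash_in G n u uA (\<lambda>a v. playV n x0 a v (T - Suc (length h)) h y) sA sV \<and>
                 as_if_pivotal n u x0 (T - Suc (length h)) sA sV h y))"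

definition setter_payoff :: "nat \<Rightarrow> ('x \<Rightarrow> real) \<Rightarrow> nat \<Rightarrow> 'x
   \<Rightarrow> 'x setter_strat \<Rightarrow> (nat \<Rightarrow> 'x voter_strat) \<Rightarrow> real" where
  "setter_payoff n uA T x0 sA sV = EU uA (play n x0 sA sV T [])"

end

theory Submission
  imports Defs
begin

text \<open>On a generic grid backward induction pins down the equilibrium outcome: with \<open>k\<close> rounds
  left and default \<open>x\<close> it is \<open>cont k x\<close>, where \<open>cont (Suc k) x\<close> is the setter's favourite among
  \<open>cont k x\<close> and those points of the range of \<open>cont k\<close> that a majority prefers to it.

  If the problem is manipulable, compactness yields \<open>\<eta> > 0\<close> such that on every fine grid each
  point worse than \<open>u\<^sub>A\<^sup>* - \<delta>\<close> has a majority-preferred improvement worth at least \<open>\<eta>\<close> to the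
  setter. The ranges of \<open>cont k\<close> decrease in \<open>k\<close>, and this property is inherited by the next range,
  because the best improvement of a surviving point survives as well. Hence every round gains
  \<open>\<eta>\<close>, with a number of rounds independent of the grid.

  Conversely, an unimprovable point \<open>x\<close> satisfies \<open>cont k x = x\<close> on every grid containing it, and
  thin indifference allows one to build arbitrarily fine generic grids around \<open>x\<close>.\<close>

section \<open>Votes and finitely supported lotteries\<close>

lemma EU_return [simp]: "EU v (return_pmf x) = v x"
  by (simp add: EU_def)

lemma EU_le:
  assumes "finite (set_pmf p)" and "\<And>z. z \<in> set_pmf p \<Longrightarrow> v z \<le> c"
  shows "EU v p \<le> c"
proof -
  have "measure_pmf.expectation p v \<le> measure_pmf.expectation p (\<lambda>_. c)"
    using assms by (intro integral_mono_AE integrable_measure_pmf_finite)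
      (auto simp: AE_measure_pmf_iff)
  then show ?thesis by (simp add: EU_def)
qed

text \<open>The gap \<open>c - v\<close> is nonnegative on the support with expectation at most 0,
  so it vanishes at every support point. This makes each proposal used by a mixing setter
  optimal.\<close>

lemma EU_ge_imp_eq:
  assumes fin: "finite (set_pmf p)" and le: "\<And>z. z \<in> set_pmf p \<Longrightarrow> v z \<le> c"
    and ge: "c \<le> EU v p" and z: "z \<in> set_pmf p"
  shows "v z = c"
proof -
  have int: "integrable (measure_pmf p) v"
    using fin by (rule integrable_measure_pmf_finite)
  have "measure_pmf.expectation p (\<lambda>x. c - v x) = c - EU v p"
    using int by (simp add: EU_def)
  moreover have "measure_pmf.expectation p (\<lambda>x. c - v x) \<ge> 0"
    using le by (intro integral_nonneg_AE) (auto simp: AE_measure_pmf_iff)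
  ultimately have "measure_pmf.expectation p (\<lambda>x. c - v x) = 0"
    using ge by simp
  then have "AE x in measure_pmf p. c - v x = 0"
    using le int by (subst (asm) integral_nonneg_eq_0_iff_AE) (auto simp: AE_measure_pmf_iff)
  then show ?thesis using z by (auto simp: AE_measure_pmf_iff)
qed

lemma bind_pmf_eq_return:
  assumes "\<And>x. x \<in> set_pmf p \<Longrightarrow> f x = return_pmf c"
  shows "bind_pmf p f = return_pmf c"
proof -
  have "bind_pmf p f = bind_pmf p (\<lambda>_. return_pmf c)"
    using assms by (intro bind_pmf_cong) auto
  then show ?thesis by simp
qed

text \<open>Reduces mixed voting to single coalitions in the support; the default value
  \<open>False\<close> of \<open>Pi_pmf\<close> keeps non-voters out of \<open>S\<close>.\<close>

lemma set_votes:
  assumes "S \<in> set_pmf (votes n sV h y)"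
  shows "S \<subseteq> {..<n}" and "i < n \<Longrightarrow> (i \<in> S) \<in> set_pmf (sV i h y)"
proof -
  obtain f where f: "f \<in> set_pmf (Pi_pmf {..<n} False (\<lambda>i. sV i h y))" and S: "S = {i. f i}"
    using assms by (auto simp: votes_def)
  have f': "f \<in> PiE_dflt {..<n} False (\<lambda>i. set_pmf (sV i h y))"
    using f by (simp add: set_Pi_pmf comp_def)
  show "S \<subseteq> {..<n}" using f' S by (auto simp: PiE_dflt_def)
  show "(i \<in> S) \<in> set_pmf (sV i h y)" if "i < n"
    using f' S that by (auto simp: PiE_dflt_def)
qed

lemma cur_default_snoc [simp]:
  "cur_default n x0 (h @ [(y, S)]) = (if passes n S then y else cur_default n x0 h)"
  by (simp add: cur_default_def)

lemma cur_default_Nil [simp]: "cur_default n x0 [] = x0"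
  by (simp add: cur_default_def)

text \<open>Play from \<open>h\<close> consults the setter's strategy only at histories at least as
  long as \<open>h\<close>. A change at \<open>h\<close> alone is therefore invisible once that
  round is over.\<close>

lemma play_cong_setter:
  assumes "\<And>h'. length h \<le> length h' \<Longrightarrow> sA h' = sA' h'"
  shows "play n x0 sA sV k h = play n x0 sA' sV k h"
  using assms
proof (induction k arbitrary: h)
  case (Suc k)
  have "play n x0 sA sV k (h @ [(y, S)]) = play n x0 sA' sV k (h @ [(y, S)])" for y S
    by (rule Suc.IH) (use Suc.prems in auto)
  then show ?case using Suc.prems[of h] by simp
qed simp

lemma play_Suc: "play n x0 sA sV (Suc k) h = bind_pmf (sA h) (playV n x0 sA sV k h)"
  by (simp add: playV_def[abs_def])

section \<open>Backward induction on a generic grid\<close>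

text \<open>Used with \<open>a\<close> and \<open>b\<close> the continuation outcomes of passage and
  rejection, rather than the policies on the ballot.\<close>

definition vote_outcome :: "nat \<Rightarrow> (nat \<Rightarrow> 'x \<Rightarrow> real) \<Rightarrow> 'x \<Rightarrow> 'x \<Rightarrow> 'x" where
  "vote_outcome n u a b = (if strict_maj n u a b then a else b)"

lemma not_strict_maj_refl [simp]: "\<not> strict_maj n u a a"
  by (simp add: strict_maj_def)

lemma vote_outcome_same [simp]: "vote_outcome n u a a = a"
  by (simp add: vote_outcome_def)

lemma passes_iff_strict_maj:
  assumes "\<And>i. i < n \<Longrightarrow> i \<in> S \<longleftrightarrow> u i b < u i a"
  shows "passes n S \<longleftrightarrow> strict_maj n u a b"
proof -
  have "S \<inter> {..<n} = {i \<in> {..<n}. u i b < u i a}" using assms by auto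
  then show ?thesis by (simp add: passes_def strict_maj_def)
qed

text \<open>Others vote sincerely. If \<open>i\<close> prefers \<open>a\<close>, the coalition
  \<open>S\<close> is contained in the sincere one, so she cannot make \<open>a\<close> win where
  sincere voting rejects it; the case of \<open>b\<close> is symmetric. She can only flip the result
  against herself.\<close>

lemma single_voter_deviation:
  assumes "\<And>j. j < n \<Longrightarrow> j \<noteq> i \<Longrightarrow> j \<in> S \<longleftrightarrow> u j b < u j a"
  shows "u i (if passes n S then a else b) \<le> u i (vote_outcome n u a b)"
proof -
  let ?W = "{j \<in> {..<n}. u j b < u j a}"
  have "u i a \<le> u i b" if "passes n S" "\<not> strict_maj n u a b"
  proof (rule ccontr)
    assume "\<not> u i a \<le> u i b"
    then have "S \<inter> {..<n} \<subseteq> ?W" using assms by (force simp: not_le)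
    then have "card (S \<inter> {..<n}) \<le> card ?W" by (intro card_mono) auto
    then show False using that by (simp add: passes_def strict_maj_def)
  qed
  moreover have "u i b \<le> u i a" if "\<not> passes n S" "strict_maj n u a b"
  proof (rule ccontr)
    assume "\<not> u i b \<le> u i a"
    then have "?W \<subseteq> S \<inter> {..<n}" using assms by (force simp: not_le)
    then have "card ?W \<le> card (S \<inter> {..<n})" by (intro card_mono) auto
    then show False using that by (simp add: passes_def strict_maj_def)
  qed
  ultimately show ?thesis by (auto simp: vote_outcome_def)
qed

text \<open>An arbitrary choice, since different proposals can lead to the same continuation outcome
  even when the setter has no ties.\<close>

definition best_proposal ::
  "'x set \<Rightarrow> nat \<Rightarrow> (nat \<Rightarrow> 'x \<Rightarrow> real) \<Rightarrow> ('x \<Rightarrow> real) \<Rightarrow> ('x \<Rightarrow> 'x) \<Rightarrow> 'x \<Rightarrow> 'x" where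
  "best_proposal G n u uA F x = (SOME y. y \<in> G \<and>
     (\<forall>y'\<in>G. uA (vote_outcome n u (F y') (F x)) \<le> uA (vote_outcome n u (F y) (F x))))"

primrec continuation ::
  "'x set \<Rightarrow> nat \<Rightarrow> (nat \<Rightarrow> 'x \<Rightarrow> real) \<Rightarrow> ('x \<Rightarrow> real) \<Rightarrow> nat \<Rightarrow> 'x \<Rightarrow> 'x" where
  "continuation G n u uA 0 x = x"
| "continuation G n u uA (Suc k) x =
     vote_outcome n u
       (continuation G n u uA k (best_proposal G n u uA (continuation G n u uA k) x))
       (continuation G n u uA k x)"

locale strict_grid =
  fixes G :: "'x set" and n :: nat and u :: "nat \<Rightarrow> 'x \<Rightarrow> real" and uA :: "'x \<Rightarrow> real"
  assumes finite_grid: "finite G" and grid_nonempty: "G \<noteq> {}"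
    and voter_inj: "\<And>i x y. i < n \<Longrightarrow> x \<in> G \<Longrightarrow> y \<in> G \<Longrightarrow> u i x = u i y \<Longrightarrow> x = y"
    and setter_inj: "\<And>x y. x \<in> G \<Longrightarrow> y \<in> G \<Longrightarrow> uA x = uA y \<Longrightarrow> x = y"
begin

abbreviation "best \<equiv> \<lambda>k. best_proposal G n u uA (continuation G n u uA k)"
abbreviation "cont \<equiv> continuation G n u uA"
abbreviation "outc \<equiv> vote_outcome n u"

abbreviation "proposals_in_grid h \<equiv> (\<forall>(y, S)\<in>set h. y \<in> G)"

lemma best_proposal:
  shows best_in_grid: "best k x \<in> G"
    and best_ge: "y \<in> G \<Longrightarrow> uA (outc (cont k y) (cont k x)) \<le> uA (cont (Suc k) x)"
proof -
  let ?f = "\<lambda>y. uA (outc (cont k y) (cont k x))"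
  have "Max (?f ` G) \<in> ?f ` G"
    using finite_grid grid_nonempty by (intro Max_in) auto
  then obtain y0 where "y0 \<in> G" "?f y0 = Max (?f ` G)" by auto
  then have "\<exists>y. y \<in> G \<and> (\<forall>y'\<in>G. ?f y' \<le> ?f y)"
    using finite_grid by (intro exI[of _ y0]) auto
  then have *: "best k x \<in> G \<and> (\<forall>y'\<in>G. ?f y' \<le> ?f (best k x))"
    unfolding best_proposal_def by (rule someI_ex)
  show "best k x \<in> G" using * by blast
  show "?f y \<le> uA (cont (Suc k) x)" if "y \<in> G" using * that by auto
qed

lemma cont_in_grid: "x \<in> G \<Longrightarrow> cont k x \<in> G"
  by (induction k arbitrary: x) (auto simp: vote_outcome_def best_in_grid)

lemma cont_mono:
  assumes "x \<in> G" shows "uA (cont k x) \<le> uA (cont (Suc k) x)"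
  \<comment> \<open>Proposing the default \<open>x\<close> itself secures
    \<open>cont k x\<close>.\<close>
  using best_ge[OF assms, of k x] by simp

text \<open>This is the shrinking of ranges: \<open>w\<close> is the best proposal or
  \<open>x\<close> itself, depending on the vote.\<close>

lemma cont_Suc_in_range:
  assumes "x \<in> G" shows "\<exists>w\<in>G. cont (Suc k) x = cont k w"
  using assms best_in_grid[of k x] by (auto simp: vote_outcome_def)

lemma cur_default_in_grid:
  assumes "x0 \<in> G" shows "proposals_in_grid h \<Longrightarrow> cur_default n x0 h \<in> G"
proof (induction h rule: rev_induct)
  case (snoc p h)
  then show ?case by (cases p) auto
qed (simp add: assms)

text \<open>A continuation that beats \<open>x\<close> by majority is weakly better for the setter
  by \<open>cont_mono\<close>, and not strictly better as \<open>x\<close> is unimprovable.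
  Antisymmetry then identifies it with \<open>x\<close>.\<close>

lemma cont_unimprovable:
  assumes "x \<in> G" and "\<not> improvable G n u uA x"
  shows "cont k x = x"
proof (induction k)
  case (Suc k)
  let ?b = "cont k (best k x)"
  have b: "?b \<in> G" by (simp add: best_in_grid cont_in_grid)
  have "?b = x" if maj: "strict_maj n u ?b x"
  proof -
    have "uA x \<le> uA ?b"
      using cont_mono[OF assms(1), of k] maj by (simp add: Suc.IH vote_outcome_def)
    moreover have "\<not> uA x < uA ?b"
      using assms(2) b maj by (auto simp: improvable_def)
    ultimately show ?thesis using setter_inj[OF b assms(1)] by simp
  qed
  then show ?case by (auto simp: Suc.IH vote_outcome_def)
qed simp

text \<open>The hypothesis \<open>gain\<close> supplies improvements anywhere in the grid, but only
  outcomes in the range of \<open>cont k\<close> are attainable. Inductively, write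
  \<open>cont (Suc k) x\<close> as \<open>cont k w\<close>. By the induction hypothesis this has an
  attainable improvement, so the setter's best outcome from default \<open>w\<close>, namely
  \<open>cont (Suc k) w\<close>, improves on it too and lies in the new range.\<close>

lemma improvement_survives:
  assumes gain: "\<And>z. z \<in> G \<Longrightarrow> uA z \<le> c \<Longrightarrow> \<exists>y\<in>G. strict_maj n u y z \<and> uA z + \<eta> \<le> uA y"
    and "\<eta> > 0" and "x \<in> G" and "uA (cont k x) \<le> c"
  shows "\<exists>y\<in>G. strict_maj n u (cont k y) (cont k x) \<and> uA (cont k x) + \<eta> \<le> uA (cont k y)"
  using assms(3,4)
proof (induction k arbitrary: x)
  case 0
  then show ?case using gain by simp
next
  case (Suc k)
  obtain w where w: "w \<in> G" "cont (Suc k) x = cont k w"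
    using cont_Suc_in_range[OF Suc.prems(1)] by blast
  obtain y where y: "y \<in> G" "strict_maj n u (cont k y) (cont k w)"
      "uA (cont k w) + \<eta> \<le> uA (cont k y)"
    using Suc.IH[OF w(1)] Suc.prems(2) w(2) by auto
  have ge: "uA (cont k w) + \<eta> \<le> uA (cont (Suc k) w)"
    using best_ge[OF y(1), of k w] y(2,3) by (simp add: vote_outcome_def)
  \<comment> \<open>A strict gain excludes rejection, whose outcome would be \<open>cont k w\<close>
    itself.\<close>
  then have "strict_maj n u (cont (Suc k) w) (cont k w)"
    using \<open>\<eta> > 0\<close> by (auto simp: vote_outcome_def split: if_splits)
  then show ?case using ge w by (intro bexI[of _ w]) simp_all
qed

text \<open>Below \<open>c\<close> each further round adds \<eta>; above \<open>c\<close>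
  monotonicity in \<open>k\<close> preserves the level, which is what the \<open>min\<close>
  records.\<close>

lemma cont_lower_bound:
  assumes gain: "\<And>z. z \<in> G \<Longrightarrow> uA z \<le> c \<Longrightarrow> \<exists>y\<in>G. strict_maj n u y z \<and> uA z + \<eta> \<le> uA y"
    and "\<eta> > 0" and "x \<in> G" and "m \<le> uA x"
  shows "min c (m + real k * \<eta>) \<le> uA (cont k x)"
proof (induction k)
  case 0
  then show ?case using assms(4) by simp
next
  case (Suc k)
  show ?case
  proof (cases "uA (cont k x) \<le> c")
    case True
    then obtain y where y: "y \<in> G" "strict_maj n u (cont k y) (cont k x)"
        "uA (cont k x) + \<eta> \<le> uA (cont k y)"
      using improvement_survives[OF gain \<open>\<eta> > 0\<close> \<open>x \<in> G\<close>] by blast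
    have "uA (cont k x) + \<eta> \<le> uA (cont (Suc k) x)"
      using best_ge[OF y(1), of k x] y(2,3) by (simp add: vote_outcome_def)
    then show ?thesis using Suc.IH \<open>\<eta> > 0\<close> by (auto simp: algebra_simps min_def split: if_splits)
  next
    case False
    then show ?thesis using cont_mono[OF \<open>x \<in> G\<close>, of k] by (simp del: continuation.simps)
  qed
qed

section \<open>Uniqueness of the equilibrium outcome\<close>

text \<open>Backward induction over all histories, on or off the path. The induction hypothesis
  makes the continuations after passage and rejection deterministic and independent of the
  composition of the vote, which is exactly when as-if-pivotal voting applies; the setter then faces
  a finite maximisation without ties.\<close>

lemma equilibrium_play:
  assumes eq: "equilibrium G n u uA T x0 sA sV" and x0: "x0 \<in> G"
    and "k + length h = T" and "\<forall>(y, S)\<in>set h. y \<in> G \<and> S \<subseteq> {..<n}"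
  shows "play n x0 sA sV k h = return_pmf (cont k (cur_default n x0 h))"
  using assms(3,4)
proof (induction k arbitrary: h)
  case (Suc k)
  let ?d = "cur_default n x0 h"
  let ?g = "\<lambda>y. outc (cont k y) (cont k ?d)"
  have vh: "valid_hist G n T h" and k: "T - Suc (length h) = k" "T - length h = Suc k"
    using Suc.prems by (auto simp: valid_hist_def)
  have valid: "valid_setter G sA"
    and nash: "nash_in G n u uA (\<lambda>a v. play n x0 a v (Suc k) h) sA sV"
    and piv: "\<And>y. y \<in> G \<Longrightarrow> as_if_pivotal n u x0 k sA sV h y"
    using eq vh k unfolding equilibrium_def by metis+
  have "proposals_in_grid h" using Suc.prems by auto
  then have d: "?d \<in> G" by (rule cur_default_in_grid[OF x0])
  have next_play: "play n x0 sA sV k (h @ [(y, S)]) =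
      return_pmf (cont k (if passes n S then y else ?d))" if "y \<in> G" "S \<subseteq> {..<n}" for y S
    using Suc.IH[of "h @ [(y, S)]"] Suc.prems that by auto
  have vote: "playV n x0 sA sV k h y = return_pmf (?g y)" if y: "y \<in> G" for y
    unfolding playV_def
  proof (rule bind_pmf_eq_return)
    fix S assume S: "S \<in> set_pmf (votes n sV h y)"
    have "cont k (if passes n S then y else ?d) = ?g y"
    \<comment> \<open>If the continuations coincide, voters are unconstrained but the result is the
      same either way. Otherwise every voter has a strict preference.\<close>
    proof (cases "cont k y = cont k ?d")
      case False
      have strict: "u i (cont k y) \<noteq> u i (cont k ?d)" if "i < n" for i
        using voter_inj[OF that, of "cont k y" "cont k ?d"] False y d cont_in_grid by blast
      have "(u i (cont k y) > u i (cont k ?d) \<longrightarrow> sV i h y = return_pmf True) \<and>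
            (u i (cont k ?d) > u i (cont k y) \<longrightarrow> sV i h y = return_pmf False)" if "i < n" for i
        using piv[OF y, unfolded as_if_pivotal_def, rule_format, of "cont k y" "cont k ?d" i]
          next_play[OF y] that by simp
      then have "i \<in> S \<longleftrightarrow> u i (cont k ?d) < u i (cont k y)" if "i < n" for i
        using set_votes(2)[OF S that] strict[OF that] that
        by (metis linorder_neqE_linordered_idom set_return_pmf singletonD)
      then have "passes n S \<longleftrightarrow> strict_maj n u (cont k y) (cont k ?d)"
        by (rule passes_iff_strict_maj)
      then show ?thesis by (simp add: vote_outcome_def)
    qed simp
    then show "play n x0 sA sV k (h @ [(y, S)]) = return_pmf (?g y)"
      using next_play[OF y set_votes(1)[OF S]] by simp
  qed
  have sup: "set_pmf (sA h) \<subseteq> G" using valid by (simp add: valid_setter_def)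
  have play_eq: "play n x0 sA sV (Suc k) h = map_pmf ?g (sA h)"
    unfolding play_Suc map_pmf_def using sup vote by (intro bind_pmf_cong) auto
  \<comment> \<open>Compare with the one-shot deviation that proposes \<open>best k ?d\<close> at
    \<open>h\<close> and changes nothing elsewhere.\<close>
  have "uA (cont (Suc k) ?d) \<le> EU uA (play n x0 sA sV (Suc k) h)"
  proof -
    let ?b = "best k ?d"
    let ?s = "sA(h := return_pmf ?b)"
    have "valid_setter G ?s" using valid best_in_grid by (auto simp: valid_setter_def)
    then have le: "EU uA (play n x0 ?s sV (Suc k) h) \<le> EU uA (play n x0 sA sV (Suc k) h)"
      using nash unfolding nash_in_def by blast
    have "play n x0 ?s sV k (h @ [p]) = play n x0 sA sV k (h @ [p])" for p
      by (rule play_cong_setter) auto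
    then have "play n x0 ?s sV (Suc k) h = playV n x0 sA sV k h ?b"
      by (simp add: playV_def bind_return_pmf)
    then show ?thesis using le vote[OF best_in_grid] by simp
  qed
  moreover have "uA z \<le> uA (cont (Suc k) ?d)" if "z \<in> ?g ` set_pmf (sA h)" for z
    using that sup best_ge by blast
  ultimately have "uA z = uA (cont (Suc k) ?d)" if "z \<in> ?g ` set_pmf (sA h)" for z
    using that finite_subset[OF sup finite_grid]
    by (intro EU_ge_imp_eq[where p = "map_pmf ?g (sA h)"]) (auto simp: play_eq simp del: play.simps)
  \<comment> \<open>Equal setter utility means equal policies on the grid, so mixing over proposals
    leaves the outcome deterministic.\<close>
  then have "?g y = cont (Suc k) ?d" if "y \<in> set_pmf (sA h)" for y
    using setter_inj[of "?g y" "cont (Suc k) ?d"] that sup d cont_in_grid[OF d, of "Suc k"]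
    by (auto simp: vote_outcome_def cont_in_grid simp del: continuation.simps)
  then show ?case
    unfolding play_eq map_pmf_def by (intro bind_pmf_eq_return) simp
qed simp

lemma equilibrium_payoff:
  assumes "equilibrium G n u uA T x0 sA sV" and "x0 \<in> G"
  shows "setter_payoff n uA T x0 sA sV = uA (cont T x0)"
  using equilibrium_play[OF assms, of T "[]"] by (simp add: setter_payoff_def)

section \<open>Existence of an equilibrium\<close>

text \<open>\<open>T - Suc (length h)\<close> counts the rounds remaining after the current
  vote.\<close>

definition eq_setter :: "nat \<Rightarrow> 'x \<Rightarrow> 'x setter_strat" where
  "eq_setter T x0 h = return_pmf (best (T - Suc (length h)) (cur_default n x0 h))"

text \<open>Indifference counts as a vote against, so a proposal passes exactly when
  \<open>strict_maj\<close> holds between the continuations.\<close>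

definition eq_voter :: "nat \<Rightarrow> 'x \<Rightarrow> nat \<Rightarrow> 'x voter_strat" where
  "eq_voter T x0 i h y = return_pmf
     (u i (cont (T - Suc (length h)) (cur_default n x0 h)) < u i (cont (T - Suc (length h)) y))"

lemma valid_eq_setter: "valid_setter G (eq_setter T x0)"
  by (simp add: valid_setter_def eq_setter_def best_in_grid)

lemma eq_vote_result:
  assumes "S \<in> set_pmf (votes n (eq_voter T x0) h y)" and "Suc k + length h = T"
  shows "cont k (if passes n S then y else cur_default n x0 h) =
    outc (cont k y) (cont k (cur_default n x0 h))"
proof -
  have k: "T - Suc (length h) = k" using assms(2) by simp
  have "passes n S \<longleftrightarrow> strict_maj n u (cont k y) (cont k (cur_default n x0 h))"
    using set_votes(2)[OF assms(1)] by (intro passes_iff_strict_maj) (simp add: eq_voter_def k)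
  then show ?thesis by (simp add: vote_outcome_def)
qed

text \<open>Conditional on the play equation for \<open>k\<close> rounds, so that it can be used
  inside the induction for \<open>eq_play\<close>; \<open>eq_playV\<close> discharges the
  condition.\<close>

lemma eq_playV_if_play:
  assumes "\<And>S. play n x0 (eq_setter T x0) (eq_voter T x0) k (h @ [(y, S)]) =
      return_pmf (cont k (if passes n S then y else cur_default n x0 h))"
    and "Suc k + length h = T"
  shows "playV n x0 (eq_setter T x0) (eq_voter T x0) k h y =
    return_pmf (outc (cont k y) (cont k (cur_default n x0 h)))"
  unfolding playV_def using eq_vote_result[OF _ assms(2)] assms(1)
  by (intro bind_pmf_eq_return) simp

lemma eq_play:
  "k + length h = T \<Longrightarrow> play n x0 (eq_setter T x0) (eq_voter T x0) k h =
    return_pmf (cont k (cur_default n x0 h))"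
proof (induction k arbitrary: h)
  case (Suc k)
  have k: "T - Suc (length h) = k" using Suc.prems by simp
  show ?case
    unfolding play_Suc using Suc.prems Suc.IH
    by (subst eq_setter_def) (simp add: bind_return_pmf k eq_playV_if_play)
qed simp

lemma eq_playV:
  assumes "Suc k + length h = T"
  shows "playV n x0 (eq_setter T x0) (eq_voter T x0) k h y =
    return_pmf (outc (cont k y) (cont k (cur_default n x0 h)))"
  using assms by (intro eq_playV_if_play) (simp_all add: eq_play)

text \<open>Against sincere voters every vote ends in \<open>outc\<close>, and
  \<open>best_ge\<close> bounds what any proposal yields. Induction on the remaining rounds covers
  deviations in many rounds at once, and bounding each support point covers mixing.\<close>

lemma setter_deviation:
  assumes valid: "valid_setter G sA" and x0: "x0 \<in> G"
  shows setter_deviation_play: "k + length h = T \<Longrightarrow> proposals_in_grid h \<Longrightarrow>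
      z \<in> set_pmf (play n x0 sA (eq_voter T x0) k h) \<Longrightarrow>
      z \<in> G \<and> uA z \<le> uA (cont k (cur_default n x0 h))"
    and setter_deviation_playV: "Suc k + length h = T \<Longrightarrow> proposals_in_grid h \<Longrightarrow> y \<in> G \<Longrightarrow>
      z \<in> set_pmf (playV n x0 sA (eq_voter T x0) k h y) \<Longrightarrow>
      z \<in> G \<and> uA z \<le> uA (outc (cont k y) (cont k (cur_default n x0 h)))"
proof -
  \<comment> \<open>The voting stage relative to the bound on play for the same \<open>k\<close>; it
    serves both the induction step and the second claim.\<close>
  have step: "z \<in> G \<and> uA z \<le> uA (outc (cont k y) (cont k (cur_default n x0 h)))"
    if IH: "\<And>h z. k + length h = T \<Longrightarrow> proposals_in_grid h \<Longrightarrow>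
        z \<in> set_pmf (play n x0 sA (eq_voter T x0) k h) \<Longrightarrow>
        z \<in> G \<and> uA z \<le> uA (cont k (cur_default n x0 h))"
      and len: "Suc k + length h = T" and h: "proposals_in_grid h" and y: "y \<in> G"
      and z: "z \<in> set_pmf (playV n x0 sA (eq_voter T x0) k h y)" for k h y z
  proof -
    obtain S where S: "S \<in> set_pmf (votes n (eq_voter T x0) h y)"
        and zS: "z \<in> set_pmf (play n x0 sA (eq_voter T x0) k (h @ [(y, S)]))"
      using z by (auto simp: playV_def)
    show ?thesis
      using IH[OF _ _ zS] len h y eq_vote_result[OF S len] by auto
  qed
  have play: "k + length h = T \<Longrightarrow> proposals_in_grid h \<Longrightarrow>
      z \<in> set_pmf (play n x0 sA (eq_voter T x0) k h) \<Longrightarrow>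
      z \<in> G \<and> uA z \<le> uA (cont k (cur_default n x0 h))" for k h z
  proof (induction k arbitrary: h z)
    case 0
    then show ?case using cur_default_in_grid[OF x0, of h] by simp
  next
    case (Suc k)
    obtain y where "y \<in> set_pmf (sA h)" and z: "z \<in> set_pmf (playV n x0 sA (eq_voter T x0) k h y)"
      using Suc.prems(3) unfolding play_Suc by auto
    then have y: "y \<in> G" using valid by (auto simp: valid_setter_def)
    have "z \<in> G \<and> uA z \<le> uA (outc (cont k y) (cont k (cur_default n x0 h)))"
      by (rule step[OF _ Suc.prems(1,2) y z]) (rule Suc.IH)
    then show ?case
      using best_ge[OF y, of k "cur_default n x0 h"]
      by (meson order_trans)
  qed
  show "k + length h = T \<Longrightarrow> proposals_in_grid h \<Longrightarrow>
      z \<in> set_pmf (play n x0 sA (eq_voter T x0) k h) \<Longrightarrow>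
      z \<in> G \<and> uA z \<le> uA (cont k (cur_default n x0 h))" by (rule play)
  show "Suc k + length h = T \<Longrightarrow> proposals_in_grid h \<Longrightarrow> y \<in> G \<Longrightarrow>
      z \<in> set_pmf (playV n x0 sA (eq_voter T x0) k h y) \<Longrightarrow>
      z \<in> G \<and> uA z \<le> uA (outc (cont k y) (cont k (cur_default n x0 h)))"
    by (rule step) (rule play)
qed

text \<open>Same scheme as for the setter, with \<open>single_voter_deviation\<close> at each vote;
  the setter's proposal is the best one, so the bound after \<open>Suc k\<close> rounds is
  \<open>cont (Suc k)\<close> by definition.\<close>

lemma voter_deviation:
  assumes x0: "x0 \<in> G"
  shows voter_deviation_play: "k + length h = T \<Longrightarrow> proposals_in_grid h \<Longrightarrow>
      z \<in> set_pmf (play n x0 (eq_setter T x0) ((eq_voter T x0)(i := s)) k h) \<Longrightarrow>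
      z \<in> G \<and> u i z \<le> u i (cont k (cur_default n x0 h))"
    and voter_deviation_playV: "Suc k + length h = T \<Longrightarrow> proposals_in_grid h \<Longrightarrow> y \<in> G \<Longrightarrow>
      z \<in> set_pmf (playV n x0 (eq_setter T x0) ((eq_voter T x0)(i := s)) k h y) \<Longrightarrow>
      z \<in> G \<and> u i z \<le> u i (outc (cont k y) (cont k (cur_default n x0 h)))"
proof -
  let ?sV = "(eq_voter T x0)(i := s)"
  let ?play = "play n x0 (eq_setter T x0) ?sV"
  let ?playV = "playV n x0 (eq_setter T x0) ?sV"
  have step: "z \<in> G \<and> u i z \<le> u i (outc (cont k y) (cont k (cur_default n x0 h)))"
    if IH: "\<And>h z. k + length h = T \<Longrightarrow> proposals_in_grid h \<Longrightarrow> z \<in> set_pmf (?play k h) \<Longrightarrow>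
        z \<in> G \<and> u i z \<le> u i (cont k (cur_default n x0 h))"
      and len: "Suc k + length h = T" and h: "proposals_in_grid h" and y: "y \<in> G"
      and z: "z \<in> set_pmf (?playV k h y)" for k h y z
  proof -
    let ?d = "cur_default n x0 h"
    have k: "T - Suc (length h) = k" using len by simp
    obtain S where S: "S \<in> set_pmf (votes n ?sV h y)"
        and zS: "z \<in> set_pmf (?play k (h @ [(y, S)]))"
      using z by (auto simp: playV_def)
    have "j \<in> S \<longleftrightarrow> u j (cont k ?d) < u j (cont k y)" if "j < n" "j \<noteq> i" for j
      using set_votes(2)[OF S that(1)] that(2) by (simp add: eq_voter_def k)
    then have "u i (if passes n S then cont k y else cont k ?d) \<le> u i (outc (cont k y) (cont k ?d))"
      by (rule single_voter_deviation)
    moreover have "z \<in> G \<and> u i z \<le> u i (cont k (if passes n S then y else ?d))"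
      using IH[OF _ _ zS] len h y by simp
    ultimately show ?thesis by (auto split: if_splits)
  qed
  have play: "k + length h = T \<Longrightarrow> proposals_in_grid h \<Longrightarrow> z \<in> set_pmf (?play k h) \<Longrightarrow>
      z \<in> G \<and> u i z \<le> u i (cont k (cur_default n x0 h))" for k h z
  proof (induction k arbitrary: h z)
    case 0
    then show ?case using cur_default_in_grid[OF x0, of h] by simp
  next
    case (Suc k)
    let ?b = "best k (cur_default n x0 h)"
    have "T - Suc (length h) = k" using Suc.prems by simp
    then have z: "z \<in> set_pmf (?playV k h ?b)"
      using Suc.prems(3) unfolding play_Suc by (auto simp: eq_setter_def)
    have "z \<in> G \<and> u i z \<le> u i (outc (cont k ?b) (cont k (cur_default n x0 h)))"
      by (rule step[OF _ Suc.prems(1,2) best_in_grid z]) (rule Suc.IH)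
    then show ?case by simp
  qed
  show "k + length h = T \<Longrightarrow> proposals_in_grid h \<Longrightarrow> z \<in> set_pmf (?play k h) \<Longrightarrow>
      z \<in> G \<and> u i z \<le> u i (cont k (cur_default n x0 h))" by (rule play)
  show "Suc k + length h = T \<Longrightarrow> proposals_in_grid h \<Longrightarrow> y \<in> G \<Longrightarrow>
      z \<in> set_pmf (?playV k h y) \<Longrightarrow>
      z \<in> G \<and> u i z \<le> u i (outc (cont k y) (cont k (cur_default n x0 h)))"
    by (rule step) (rule play)
qed

lemma EU_le_grid:
  assumes "\<And>z. z \<in> set_pmf p \<Longrightarrow> z \<in> G \<and> v z \<le> c"
  shows "EU v p \<le> c"
  using assms by (intro EU_le) (auto intro: finite_subset[OF _ finite_grid])

lemma eq_nash_play:
  assumes "x0 \<in> G" and "k + length h = T" and "proposals_in_grid h"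
  shows "nash_in G n u uA (\<lambda>a v. play n x0 a v k h) (eq_setter T x0) (eq_voter T x0)"
  unfolding nash_in_def eq_play[OF assms(2)] EU_return
  using setter_deviation_play[OF _ assms] voter_deviation_play[OF assms]
  by (intro conjI allI impI; intro EU_le_grid) blast+

lemma eq_nash_playV:
  assumes "x0 \<in> G" and "Suc k + length h = T" and "proposals_in_grid h" and "y \<in> G"
  shows "nash_in G n u uA (\<lambda>a v. playV n x0 a v k h y) (eq_setter T x0) (eq_voter T x0)"
  unfolding nash_in_def eq_playV[OF assms(2)] EU_return
  using setter_deviation_playV[OF _ assms] voter_deviation_playV[OF assms]
  by (intro conjI allI impI; intro EU_le_grid) blast+

lemma eq_as_if_pivotal:
  assumes "n > 0" and "Suc k + length h = T"
  shows "as_if_pivotal n u x0 k (eq_setter T x0) (eq_voter T x0) h y"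
  unfolding as_if_pivotal_def
proof (intro allI impI)
  fix x z i
  let ?d = "cur_default n x0 h"
  let ?play = "\<lambda>S. play n x0 (eq_setter T x0) (eq_voter T x0) k (h @ [(y, S)])"
  assume A: "(\<forall>S\<subseteq>{..<n}. passes n S \<longrightarrow> ?play S = return_pmf x) \<and>
    (\<forall>S\<subseteq>{..<n}. \<not> passes n S \<longrightarrow> ?play S = return_pmf z)" and "i < n"
  have P: "?play S = return_pmf (cont k (if passes n S then y else ?d))" for S
    using assms(2) by (simp add: eq_play)
  \<comment> \<open>Both a passing and a failing coalition exist, which forces \<open>x\<close> and
    \<open>z\<close> to be the two continuations.\<close>
  have "passes n {..<n}" "\<not> passes n {}" using \<open>n > 0\<close> by (simp_all add: passes_def)
  then have x: "x = cont k y" "z = cont k ?d"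
    using A P[of "{..<n}"] P[of "{}"] by auto
  have "T - Suc (length h) = k" using assms(2) by simp
  then show "(u i x > u i z \<longrightarrow> eq_voter T x0 i h y = return_pmf True) \<and>
      (u i z > u i x \<longrightarrow> eq_voter T x0 i h y = return_pmf False)"
    by (simp add: x eq_voter_def)
qed

text \<open>Keeps the payoff guarantee from being vacuous: refuting it for an unimprovable default
  requires an actual equilibrium.\<close>

lemma eq_equilibrium:
  assumes "x0 \<in> G" and "n > 0"
  shows "equilibrium G n u uA T x0 (eq_setter T x0) (eq_voter T x0)"
  unfolding equilibrium_def
proof (intro conjI allI impI ballI)
  show "valid_setter G (eq_setter T x0)" by (rule valid_eq_setter)
next
  fix h assume "valid_hist G n T h"
  then have len: "(T - length h) + length h = T" "Suc (T - Suc (length h)) + length h = T"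
    and h: "proposals_in_grid h"
    by (auto simp: valid_hist_def)
  show "nash_in G n u uA (\<lambda>a v. play n x0 a v (T - length h) h) (eq_setter T x0) (eq_voter T x0)"
    using assms(1) len(1) h by (rule eq_nash_play)
  fix y assume y: "y \<in> G"
  show "nash_in G n u uA (\<lambda>a v. playV n x0 a v (T - Suc (length h)) h y)
      (eq_setter T x0) (eq_voter T x0)"
    using assms(1) len(2) h y by (rule eq_nash_playV)
  show "as_if_pivotal n u x0 (T - Suc (length h)) (eq_setter T x0) (eq_voter T x0) h y"
    using assms(2) len(2) by (rule eq_as_if_pivotal)
qed

end

lemma strict_grid_if_generic:
  assumes "generic_grid X n u uA \<epsilon> G" shows "strict_grid G n u uA"
  using assms by unfold_locales (auto simp: generic_grid_def)

section \<open>Uniform improvements on fine grids\<close>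

lemma strict_preference_stable:
  fixes f :: "'x::metric_space \<Rightarrow> real"
  assumes "continuous_on X f" and "x \<in> X" and "y \<in> X" and "f x < f y"
  shows "\<exists>r>0. \<forall>x'\<in>X. \<forall>y'\<in>X. dist x' x < r \<longrightarrow> dist y' y < r \<longrightarrow> f x' + r \<le> f y'"
proof -
  \<comment> \<open>One third of the gap may be lost at each end; the last third remains as the
    margin.\<close>
  define c where "c = (f y - f x) / 3"
  have c: "c > 0" using assms(4) by (simp add: c_def)
  obtain r1 where r1: "r1 > 0" "\<And>x'. x' \<in> X \<Longrightarrow> dist x' x < r1 \<Longrightarrow> dist (f x') (f x) < c"
    using assms(1,2) c unfolding continuous_on_iff by metis
  obtain r2 where r2: "r2 > 0" "\<And>y'. y' \<in> X \<Longrightarrow> dist y' y < r2 \<Longrightarrow> dist (f y') (f y) < c"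
    using assms(1,3) c unfolding continuous_on_iff by metis
  have "f x' + min c (min r1 r2) \<le> f y'"
    if "x' \<in> X" "y' \<in> X" "dist x' x < min c (min r1 r2)" "dist y' y < min c (min r1 r2)" for x' y'
  proof -
    have "f x' < f x + c" "f y - c < f y'"
      using r1(2)[of x'] r2(2)[of y'] that by (auto simp: dist_real_def)
    moreover have "f y = f x + 3 * c" by (simp add: c_def field_simps)
    ultimately show ?thesis by linarith
  qed
  then show ?thesis using c r1(1) r2(1) by (intro exI[of _ "min c (min r1 r2)"]) auto
qed

text \<open>Only the setter and the finitely many voters in the supporting coalition
  \<open>I\<close> are tracked. Each has a stability radius, and the least of these keeps all of
  \<open>I\<close> in favour.\<close>

lemma improvement_stable:
  fixes u :: "nat \<Rightarrow> 'x::metric_space \<Rightarrow> real"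
  assumes cont: "\<And>i. i < n \<Longrightarrow> continuous_on X (u i)" "continuous_on X uA"
    and x: "x \<in> X" and y: "y \<in> X" and "uA x < uA y" and maj: "strict_maj n u y x"
  shows "\<exists>r>0. \<forall>x'\<in>X. \<forall>y'\<in>X. dist x' x < r \<longrightarrow> dist y' y < r \<longrightarrow>
    uA x' + r \<le> uA y' \<and> strict_maj n u y' x'"
proof -
  define I where "I = {i \<in> {..<n}. u i y > u i x}"
  obtain rA where rA: "rA > 0" "\<And>x' y'. x' \<in> X \<Longrightarrow> y' \<in> X \<Longrightarrow> dist x' x < rA \<Longrightarrow>
      dist y' y < rA \<Longrightarrow> uA x' + rA \<le> uA y'"
    using strict_preference_stable[OF cont(2) x y \<open>uA x < uA y\<close>] by metis
  have "\<forall>i\<in>I. \<exists>r>0. \<forall>x'\<in>X. \<forall>y'\<in>X. dist x' x < r \<longrightarrow> dist y' y < r \<longrightarrow> u i x' + r \<le> u i y'"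
    using cont(1) x y by (intro ballI strict_preference_stable) (auto simp: I_def)
  then obtain r where r: "\<And>i. i \<in> I \<Longrightarrow> r i > 0" "\<And>i x' y'. i \<in> I \<Longrightarrow> x' \<in> X \<Longrightarrow> y' \<in> X \<Longrightarrow>
      dist x' x < r i \<Longrightarrow> dist y' y < r i \<Longrightarrow> u i x' + r i \<le> u i y'"
    by metis
  have fin: "finite I" by (simp add: I_def)
  define m where "m = Min (insert rA (r ` I))"
  have m: "m > 0" "m \<le> rA" "\<And>i. i \<in> I \<Longrightarrow> m \<le> r i"
    using fin r(1) rA(1) by (auto simp: m_def)
  have "uA x' + m \<le> uA y' \<and> strict_maj n u y' x'"
    if "x' \<in> X" "y' \<in> X" "dist x' x < m" "dist y' y < m" for x' y'
  proof
    show "uA x' + m \<le> uA y'" using rA(2)[of x' y'] that m(2) by simp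
    have "u i x' < u i y'" if i: "i \<in> I" for i
      using r(1)[OF i] r(2)[OF i, of x' y'] m(3)[OF i] \<open>x' \<in> X\<close> \<open>y' \<in> X\<close> \<open>dist x' x < m\<close> \<open>dist y' y < m\<close>
      by simp
    then have "card I \<le> card {i \<in> {..<n}. u i y' > u i x'}"
      by (intro card_mono) (auto simp: I_def)
    then show "strict_maj n u y' x'" using maj by (simp add: strict_maj_def I_def)
  qed
  then show ?thesis using m(1) by blast
qed

text \<open>The set where \<open>uA\<close> is at most \<open>c\<close> is compact, so finitely many
  stable improvements \<open>Y a\<close> cover it. The improvement holds on a whole \<eta>-ball
  around \<open>y\<close>, so that every sufficiently fine grid meets it.\<close>

lemma uniform_improvement:
  fixes u :: "nat \<Rightarrow> 'x::metric_space \<Rightarrow> real"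
  assumes "compact X" and cont: "\<And>i. i < n \<Longrightarrow> continuous_on X (u i)" "continuous_on X uA"
    and imp: "\<And>x. x \<in> X \<Longrightarrow> uA x \<le> c \<Longrightarrow> improvable X n u uA x"
  shows "\<exists>\<eta>>0. \<forall>x\<in>X. uA x \<le> c \<longrightarrow>
    (\<exists>y\<in>X. \<forall>y'\<in>X. dist y' y < \<eta> \<longrightarrow> uA x + \<eta> \<le> uA y' \<and> strict_maj n u y' x)"
proof -
  define K where "K = {x \<in> X. uA x \<le> c}"
  have "closedin (top_of_set X) (X \<inter> uA -` {..c})"
    using cont(2) by (intro continuous_closedin_preimage) auto
  moreover have "X \<inter> uA -` {..c} = K" by (auto simp: K_def)
  ultimately have compactK: "compact K" using \<open>compact X\<close> closedin_compact by metis
  have "\<exists>y r. y \<in> X \<and> r > 0 \<and> (\<forall>x'\<in>X. \<forall>y'\<in>X. dist x' x < r \<longrightarrow> dist y' y < r \<longrightarrow>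
      uA x' + r \<le> uA y' \<and> strict_maj n u y' x')" if "x \<in> K" for x
  proof -
    have x: "x \<in> X" "improvable X n u uA x" using that imp by (auto simp: K_def)
    then obtain y where "y \<in> X" "uA x < uA y" "strict_maj n u y x"
      by (auto simp: improvable_def)
    then show ?thesis using improvement_stable[of n X u uA x y] cont x(1) by blast
  qed
  then obtain Y r where Y: "\<And>x. x \<in> K \<Longrightarrow> Y x \<in> X" and r: "\<And>x. x \<in> K \<Longrightarrow> r x > 0"
    and Yr: "\<And>x x' y'. x \<in> K \<Longrightarrow> x' \<in> X \<Longrightarrow> y' \<in> X \<Longrightarrow> dist x' x < r x \<Longrightarrow> dist y' (Y x) < r x \<Longrightarrow>
      uA x' + r x \<le> uA y' \<and> strict_maj n u y' x'"
    by metis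
  have "K \<subseteq> (\<Union>x\<in>K. ball x (r x))" using r by auto
  then obtain C where C: "C \<subseteq> K" "finite C" "K \<subseteq> (\<Union>x\<in>C. ball x (r x))"
    by (rule compactE_image[OF compactK, rotated]) auto
  \<comment> \<open>The extra 1 covers an empty \<open>C\<close>, when no policy lies below the
    threshold.\<close>
  define \<eta> where "\<eta> = Min (insert 1 (r ` C))"
  have \<eta>: "\<eta> > 0" "\<And>x. x \<in> C \<Longrightarrow> \<eta> \<le> r x"
    using C r by (auto simp: \<eta>_def)
  have "\<exists>y\<in>X. \<forall>y'\<in>X. dist y' y < \<eta> \<longrightarrow> uA x + \<eta> \<le> uA y' \<and> strict_maj n u y' x"
    if "x \<in> X" "uA x \<le> c" for x
  proof -
    obtain a where a: "a \<in> C" "dist x a < r a"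
      using C(3) \<open>x \<in> X\<close> \<open>uA x \<le> c\<close> by (force simp: K_def dist_commute)
    then have "a \<in> K" using C(1) by auto
    then show ?thesis
      using Y[of a] Yr[of a x] a \<eta>(2)[OF a(1)] that(1) by (intro bexI[of _ "Y a"]) force+
  qed
  then show ?thesis using \<eta>(1) by blast
qed

text \<open>A real supremum dominates its members only for sets bounded above; compactness of
  \<open>X\<close> supplies this.\<close>

lemma generic_grid_dense:
  assumes "compact X" and "generic_grid X n u uA \<epsilon> G" and "x \<in> X"
  shows "\<exists>g\<in>G. dist g x < \<epsilon>"
proof -
  have G: "finite G" "G \<noteq> {}" "(SUP x\<in>X. infdist x G) < \<epsilon>"
    using assms(2) by (auto simp: generic_grid_def)
  have "compact ((\<lambda>x. infdist x G) ` X)"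
    using \<open>compact X\<close> by (intro compact_continuous_image continuous_intros)
  then have "bdd_above ((\<lambda>x. infdist x G) ` X)"
    by (intro bounded_imp_bdd_above compact_imp_bounded)
  then have "infdist x G < \<epsilon>"
    using cSUP_upper[OF \<open>x \<in> X\<close>] G(3) by (meson order_le_less_trans)
  then show ?thesis
    using G(2) cINF_less_iff[of G "dist x" \<epsilon>] bdd_belowI2[of G 0 "dist x"]
    by (auto simp: infdist_def dist_commute)
qed

section \<open>Generic grids through a given point\<close>

text \<open>A finite Baire argument: removing one closed set at a time leaves a nonempty relatively
  open set.\<close>

lemma avoid_thin_sets:
  assumes "finite \<C>" and "openin (top_of_set X) U" and "U \<noteq> {}"
    and "\<And>C. C \<in> \<C> \<Longrightarrow> closedin (top_of_set X) C"
    and "\<And>C V. C \<in> \<C> \<Longrightarrow> openin (top_of_set X) V \<Longrightarrow> V \<noteq> {} \<Longrightarrow> V \<subseteq> U \<Longrightarrow> \<not> V \<subseteq> C"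
  shows "U - \<Union>\<C> \<noteq> {}"
  using assms
proof (induction \<C> arbitrary: U rule: finite_induct)
  case (insert C \<C>)
  have "openin (top_of_set X) (U - C)" using insert.prems by (intro openin_diff) auto
  moreover have "U - C \<noteq> {}" using insert.prems(4)[of C U] insert.prems(1,2) by blast
  ultimately have "(U - C) - \<Union>\<C> \<noteq> {}"
    using insert.prems(3,4) by (intro insert.IH) blast+
  then show ?case by auto
qed simp

text \<open>The ball around \<open>c\<close> misses \<open>G\<close>, so an open set inside it and
  inside the indifference set of \<open>g\<close> would avoid \<open>g\<close> and contradict
  thinness. Hence these finitely many closed sets cannot cover the ball.\<close>

lemma generic_extension:
  fixes X :: "'x::metric_space set"
  assumes P: "finite P" "\<And>v. v \<in> P \<Longrightarrow> continuous_on X v" "\<And>v. v \<in> P \<Longrightarrow> thin_indiff_player X v"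
    and G: "finite G" "G \<subseteq> X" and "c \<in> X" and "r > 0" and far: "\<And>g. g \<in> G \<Longrightarrow> r \<le> dist c g"
  shows "\<exists>g\<in>X. dist c g < r \<and> (\<forall>v\<in>P. \<forall>g'\<in>G. v g \<noteq> v g')"
proof -
  let ?U = "X \<inter> ball c r"
  let ?C = "(\<lambda>(v, g). indiff_set X v g) ` (P \<times> G)"
  have "?U - \<Union>?C \<noteq> {}"
  proof (rule avoid_thin_sets)
    show "finite ?C" using P(1) G(1) by simp
    show "openin (top_of_set X) ?U" by (simp add: openin_open_Int)
    show "?U \<noteq> {}" using \<open>c \<in> X\<close> \<open>r > 0\<close> by auto
  next
    fix C assume "C \<in> ?C"
    then obtain v g where v: "v \<in> P" and g: "g \<in> G" and C: "C = indiff_set X v g" by auto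
    have "indiff_set X v g = X \<inter> v -` {v g}" by (auto simp: indiff_set_def)
    then show "closedin (top_of_set X) C"
      using P(2)[OF v] by (simp add: C continuous_closedin_preimage)
    fix V assume V: "openin (top_of_set X) V" "V \<noteq> {}" "V \<subseteq> ?U"
    show "\<not> V \<subseteq> C"
    proof
      assume "V \<subseteq> C"
      moreover have "g \<notin> V" using V(3) far[OF g] by auto
      ultimately have "V \<subseteq> (top_of_set X) interior_of (indiff_set X v g - {g})"
        using V(1) C by (intro interior_of_maximal) auto
      then show False
        using V(2) P(3)[OF v] g G(2) by (auto simp: thin_indiff_player_def)
    qed
  qed
  then obtain g where "g \<in> ?U" "g \<notin> \<Union>?C" by blast
  then show ?thesis
    by (intro bexI[of _ g]) (auto simp: indiff_set_def)
qed

text \<open>Start from \<open>{x}\<close> and treat the centres in turn, adding a point only if no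
  existing one is within \<open>r\<close>; that is precisely the distance condition of
  \<open>generic_extension\<close>.\<close>

lemma generic_net_exists:
  fixes X :: "'x::metric_space set"
  assumes P: "finite P" "\<And>v. v \<in> P \<Longrightarrow> continuous_on X v" "\<And>v. v \<in> P \<Longrightarrow> thin_indiff_player X v"
    and "x \<in> X" and "r > 0" and "finite N" and "N \<subseteq> X"
  shows "\<exists>G. finite G \<and> G \<subseteq> X \<and> x \<in> G \<and> (\<forall>v\<in>P. inj_on v G) \<and> (\<forall>c\<in>N. \<exists>g\<in>G. dist c g < r)"
  using assms(6,7)
proof (induction N rule: finite_induct)
  case empty
  show ?case using \<open>x \<in> X\<close> by (intro exI[of _ "{x}"]) simp
next
  case (insert c N)
  then obtain G where G: "finite G" "G \<subseteq> X" "x \<in> G" "\<forall>v\<in>P. inj_on v G"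
      "\<forall>c\<in>N. \<exists>g\<in>G. dist c g < r"
    by auto
  show ?case
  proof (cases "\<exists>g\<in>G. dist c g < r")
    case True
    then show ?thesis using G by (intro exI[of _ G]) auto
  next
    case False
    then obtain g where g: "g \<in> X" "dist c g < r" "\<forall>v\<in>P. \<forall>g'\<in>G. v g \<noteq> v g'"
      using generic_extension[of P X G c r] P G(1,2) insert.prems \<open>r > 0\<close>
      by (metis insert_subset not_less)
    have "inj_on v (insert g G)" if "v \<in> P" for v
      using G(4) g(3) that by (auto simp: inj_on_insert)
    then show ?thesis using G g by (intro exI[of _ "insert g G"]) auto
  qed
qed

lemma generic_grid_exists:
  fixes X :: "'x::metric_space set"
  assumes "compact X" and x: "x \<in> X" and "\<epsilon> > 0"
    and cont: "\<And>i. i < n \<Longrightarrow> continuous_on X (u i)" "continuous_on X uA"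
    and thin: "thin_individual_indifference X n u uA"
  shows "\<exists>G. generic_grid X n u uA \<epsilon> G \<and> x \<in> G"
proof -
  let ?P = "insert uA (u ` {..<n})"
  \<comment> \<open>Passing through a net point gives distance at most \<open>2 * r\<close>; this is
    half of \<epsilon>, so the supremum stays strictly below \<epsilon>.\<close>
  define r where "r = \<epsilon> / 4"
  have r: "r > 0" using \<open>\<epsilon> > 0\<close> by (simp add: r_def)
  obtain N where N: "finite N" "N \<subseteq> X" "X \<subseteq> (\<Union>c\<in>N. ball c r)"
    using compactE_image[OF \<open>compact X\<close>, of X "\<lambda>c. ball c r"] r by force
  have "\<exists>G. finite G \<and> G \<subseteq> X \<and> x \<in> G \<and> (\<forall>v\<in>?P. inj_on v G) \<and> (\<forall>c\<in>N. \<exists>g\<in>G. dist c g < r)"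
    using cont thin x r N(1,2)
    by (intro generic_net_exists) (auto simp: thin_individual_indifference_def)
  then obtain G where G: "finite G" "G \<subseteq> X" "x \<in> G" "\<forall>v\<in>?P. inj_on v G"
      "\<forall>c\<in>N. \<exists>g\<in>G. dist c g < r"
    by blast
  have "infdist z G \<le> 2 * r" if "z \<in> X" for z
  proof -
    obtain c where c: "c \<in> N" "dist c z < r" using N(3) \<open>z \<in> X\<close> by force
    obtain g where g: "g \<in> G" "dist c g < r" using G(5) c(1) by auto
    have "dist z g \<le> 2 * r"
      using dist_triangle2[of z g c] c(2) g(2) by (simp add: dist_commute)
    then show ?thesis using infdist_le2[OF g(1)] by blast
  qed
  then have "(SUP z\<in>X. infdist z G) \<le> 2 * r" using x by (intro cSUP_least) auto
  then have "(SUP z\<in>X. infdist z G) < \<epsilon>" using r by (simp add: r_def)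
  then show ?thesis
    using G by (intro exI[of _ G]) (auto simp: generic_grid_def dest: inj_onD)
qed

section \<open>The characterisation\<close>

theorem theorem2:
  fixes X :: "'x::metric_space set"
    and n :: nat
    and u :: "nat \<Rightarrow> 'x \<Rightarrow> real"
    and uA :: "'x \<Rightarrow> real"
  assumes "compact X" and "X \<noteq> {}"
    and "odd n"
    and "\<And>i. i < n \<Longrightarrow> continuous_on X (u i)"
    and "continuous_on X uA"
    and "thin_individual_indifference X n u uA"
  shows "(\<forall>\<delta>>0. \<exists>\<epsilon>\<delta>>0. \<exists>T\<delta>::nat.
            \<forall>\<epsilon> G. \<epsilon> < \<epsilon>\<delta> \<longrightarrow> generic_grid X n u uA \<epsilon> G \<longrightarrow>
              (\<forall>T\<ge>T\<delta>. \<forall>x0\<in>G. \<forall>sA sV. equilibrium G n u uA T x0 sA sV \<longrightarrow>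
                 setter_payoff n uA T x0 sA sV \<ge> setter_max X uA - \<delta>))
         \<longleftrightarrow> manipulable X n u uA" (is "?L \<longleftrightarrow> ?R")
proof
  have bounded: "bounded (uA ` X)"
    using assms(1,5) by (intro compact_imp_bounded compact_continuous_image)
  have le_max: "uA x \<le> setter_max X uA" if "x \<in> X" for x
    unfolding setter_max_def using that bounded_imp_bdd_above[OF bounded] by (intro cSup_upper) auto
  show ?R if L: ?L
  proof (rule ccontr)
    assume "\<not> ?R"
    then obtain x where x: "x \<in> X" "x \<notin> setter_opt X uA" "\<not> improvable X n u uA x"
      by (auto simp: manipulable_def)
    then obtain y where "y \<in> X" "uA x < uA y" by (auto simp: setter_opt_def not_le)
    then have lt: "uA x < setter_max X uA" using le_max[of y] by simp
    \<comment> \<open>Half the shortfall at \<open>x\<close>, so that the guaranteed payoff strictly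
      exceeds \<open>uA x\<close>.\<close>
    define \<delta> where "\<delta> = (setter_max X uA - uA x) / 2"
    have "\<delta> > 0" using lt by (simp add: \<delta>_def)
    then obtain \<epsilon>\<delta> T where "\<epsilon>\<delta> > 0" and high: "\<And>\<epsilon> G x0 sA sV. \<epsilon> < \<epsilon>\<delta> \<Longrightarrow>
        generic_grid X n u uA \<epsilon> G \<Longrightarrow> x0 \<in> G \<Longrightarrow> equilibrium G n u uA T x0 sA sV \<Longrightarrow>
        setter_payoff n uA T x0 sA sV \<ge> setter_max X uA - \<delta>"
      using L[rule_format, of \<delta>] by (meson order_refl)
    obtain G where G: "generic_grid X n u uA (\<epsilon>\<delta> / 2) G" "x \<in> G"
      using generic_grid_exists[OF assms(1) x(1), of "\<epsilon>\<delta> / 2" n u uA] assms(4-6) \<open>\<epsilon>\<delta> > 0\<close> by auto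
    interpret strict_grid G n u uA using G(1) by (rule strict_grid_if_generic)
    have "n > 0" using assms(3) by (rule odd_pos)
    then have eq: "equilibrium G n u uA T x (eq_setter T x) (eq_voter T x)"
      by (rule eq_equilibrium[OF G(2)])
    \<comment> \<open>A grid offers only policies of \<open>X\<close>, so \<open>x\<close> stays
      unimprovable there and, as initial default, is never left.\<close>
    have "\<not> improvable G n u uA x"
      using x(3) G(1) by (auto simp: improvable_def generic_grid_def)
    then have "setter_payoff n uA T x (eq_setter T x) (eq_voter T x) = uA x"
      using equilibrium_payoff[OF eq G(2)] cont_unimprovable[OF G(2)] by simp
    then have "setter_max X uA - \<delta> \<le> uA x"
      using high[OF _ G eq] \<open>\<epsilon>\<delta> > 0\<close> by simp
    then show False using lt by (simp add: \<delta>_def field_simps)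
  qed
  show ?L if ?R
  proof (intro allI impI)
    fix \<delta> :: real assume "\<delta> > 0"
    let ?c = "setter_max X uA - \<delta>"
    have "improvable X n u uA x" if "x \<in> X" "uA x \<le> ?c" for x
    proof -
      have "x \<notin> setter_opt X uA"
      proof
        assume "x \<in> setter_opt X uA"
        then have "setter_max X uA \<le> uA x"
          unfolding setter_max_def using assms(2) by (intro cSup_least) (auto simp: setter_opt_def)
        then show False using that(2) \<open>\<delta> > 0\<close> by simp
      qed
      then show ?thesis using \<open>?R\<close> that(1) by (simp add: manipulable_def)
    qed
    then obtain \<eta> where \<eta>: "\<eta> > 0" "\<And>x. x \<in> X \<Longrightarrow> uA x \<le> ?c \<Longrightarrow>
        \<exists>y\<in>X. \<forall>y'\<in>X. dist y' y < \<eta> \<longrightarrow> uA x + \<eta> \<le> uA y' \<and> strict_maj n u y' x"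
      using uniform_improvement[of X n u uA ?c] assms(1,4,5) by metis
    obtain m where m: "\<And>x. x \<in> X \<Longrightarrow> m \<le> uA x"
      using bounded_imp_bdd_below[OF bounded] by (auto simp: bdd_below_def)
    \<comment> \<open>Enough gains of \<eta> to climb from the lower bound \<open>m\<close> past
      \<open>?c\<close>; \<open>m\<close> and \<eta> depend on \<open>X\<close> alone, so
      \<open>T0\<close> is uniform over grids.\<close>
    obtain T0 :: nat where T0: "?c - m < real T0 * \<eta>"
      using reals_Archimedean3[OF \<eta>(1)] by blast
    have "?c \<le> setter_payoff n uA T x0 sA sV"
      if "\<epsilon> < \<eta>" and grid: "generic_grid X n u uA \<epsilon> G" and "T \<ge> T0" and x0: "x0 \<in> G"
        and eq: "equilibrium G n u uA T x0 sA sV" for \<epsilon> G T x0 sA sV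
    proof -
      interpret strict_grid G n u uA using grid by (rule strict_grid_if_generic)
      have GX: "G \<subseteq> X" using grid by (simp add: generic_grid_def)
      have gain: "\<exists>y\<in>G. strict_maj n u y z \<and> uA z + \<eta> \<le> uA y" if "z \<in> G" "uA z \<le> ?c" for z
      proof -
        obtain y where y: "y \<in> X"
            "\<And>y'. y' \<in> X \<Longrightarrow> dist y' y < \<eta> \<Longrightarrow> uA z + \<eta> \<le> uA y' \<and> strict_maj n u y' z"
          using \<eta>(2)[of z] \<open>z \<in> G\<close> \<open>uA z \<le> ?c\<close> GX by blast
        \<comment> \<open>A grid point in the \<eta>-ball around \<open>y\<close> is itself an
          improvement, which is why \<eta> serves as the mesh threshold.\<close>
        obtain g where "g \<in> G" "dist g y < \<epsilon>"
          using generic_grid_dense[OF assms(1) grid y(1)] by blast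
        then show ?thesis using y(2)[of g] GX \<open>\<epsilon> < \<eta>\<close> by (intro bexI[of _ g]) auto
      qed
      have "min ?c (m + real T * \<eta>) \<le> uA (continuation G n u uA T x0)"
        using cont_lower_bound[OF gain \<eta>(1) x0] m GX x0 by blast
      moreover have "real T0 * \<eta> \<le> real T * \<eta>"
        using \<open>T \<ge> T0\<close> \<eta>(1) by simp
      ultimately show ?thesis
        using T0 equilibrium_payoff[OF eq x0] by linarith
    qed
    then show "\<exists>\<epsilon>\<delta>>0. \<exists>T\<delta>::nat. \<forall>\<epsilon> G. \<epsilon> < \<epsilon>\<delta> \<longrightarrow> generic_grid X n u uA \<epsilon> G \<longrightarrow>
        (\<forall>T\<ge>T\<delta>. \<forall>x0\<in>G. \<forall>sA sV. equilibrium G n u uA T x0 sA sV \<longrightarrow>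
           setter_payoff n uA T x0 sA sV \<ge> ?c)"
      using \<eta>(1) by blast
  qed
qed

end
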